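(* Let $m,N,k\ge1$ be integers and let $b_N=N-1$. Let $H=\Phi T$ be a block Hankel matrix, where $T=(A_{i-j})_{i,j=1}^N$ and $A_s=(a_{pq}(s))_{p,q=1}^m$ are $m\times m$ matrices, $-b_N\le s\le b_N$. Then, if $k$ is even, $$\mathrm{tr}(H^k)=\sum_{i=1}^N\sum_{j_1,\dots,j_k=-b_N}^{b_N}\mathrm{tr}(A_{j_1}\cdots A_{j_k})\prod_{l=1}^kI_{[1,N]}\Big(i-\sum_{q=1}^l(-1)^qj_q\Big)\,\delta_{0,\sum_{q=1}^k(-1)^qj_q},$$ and if $k$ is odd, $$\mathrm{tr}(H^k)=\sum_{i=1}^N\sum_{j_1,\dots,j_k=-b_N}^{b_N}\mathrm{tr}(A_{j_1}\cdots A_{j_k})\prod_{l=1}^kI_{[1,N]}\Big(i-\sum_{q=1}^l(-1)^qj_q\Big)\,\delta_{2i-1-N,\sum_{q=1}^k(-1)^qj_q},$$ where $$\mathrm{tr}(A_{j_1}\cdots A_{j_k})=\sum_{t_1,\dots,t_k=1}^m a_{t_1t_2}(j_1)\cdots a_{t_kt_1}(j_k).$$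
   Context: $T=(A_{i-j})_{i,j=1}^N$ denotes the $mN\times mN$ (block Toeplitz) matrix made of $N^2$ blocks of size $m\times m$ whose $(i,j)$ block is $A_{i-j}$. $\Phi$ is the $mN\times mN$ block matrix with $N^2$ blocks of size $m\times m$ whose $(i,j)$ block is the identity matrix $I_m$ if $i+j=N+1$ and $0$ otherwise. A block Hankel matrix is a matrix of the form $H=\Phi T$ with $T$ block Toeplitz. $I_{[1,N]}$ is the indicator function of the interval $[1,N]$ and $\delta$ is the Kronecker delta. *)

theory Defs
  imports
    "Jordan_Normal_Form.Matrix"
    "HOL-Library.FuncSet"
    "HOL-Library.Indicator_Function"
begin

definition mat_trace :: "'a::comm_monoid_add mat \<Rightarrow> 'a" where
  "mat_trace M = (\<Sum>i<dim_row M. M $$ (i, i))"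

(* mat_list_prod m [B1, ..., Bk] = B1 * ... * Bk for m x m matrices; the size m is needed
   for the empty product only. *)
definition mat_list_prod :: "nat \<Rightarrow> 'a::semiring_1 mat list \<Rightarrow> 'a mat" where
  "mat_list_prod m Bs = foldr (*) Bs (1\<^sub>m m)"

(* The block indices i, j run over 1, ..., N, whereas the rows and columns of a matrix are
   numbered from 0: row r lies in block row r div m + 1, at position r mod m. *)
definition block_mat :: "nat \<Rightarrow> nat \<Rightarrow> (nat \<Rightarrow> nat \<Rightarrow> 'a mat) \<Rightarrow> 'a mat" where
  "block_mat m N B =
     mat (m * N) (m * N) (\<lambda>(r, c). B (r div m + 1) (c div m + 1) $$ (r mod m, c mod m))"

definition block_toeplitz :: "nat \<Rightarrow> nat \<Rightarrow> (int \<Rightarrow> 'a mat) \<Rightarrow> 'a mat" where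
  "block_toeplitz m N A = block_mat m N (\<lambda>i j. A (int i - int j))"

definition block_exchange :: "nat \<Rightarrow> nat \<Rightarrow> 'a::zero_neq_one mat" where
  "block_exchange m N =
     block_mat m N (\<lambda>i j. if i + j = N + 1 then 1\<^sub>m m else 0\<^sub>m m m)"

definition kronecker_delta :: "'i \<Rightarrow> 'i \<Rightarrow> 'a::zero_neq_one" where
  "kronecker_delta x y = (if x = y then 1 else 0)"

end

theory Submission
  imports Defs
begin

text \<open>
  The exchange matrix turns block row \<open>i\<close> into block row \<open>N + 1 - i\<close>, so the \<open>(i, j)\<close> block of
  the Hankel matrix \<open>H\<close> is \<open>A (N + 1 - i - j)\<close>. The trace of \<open>H ^ k\<close> is therefore a sum over
  closed walks \<open>i\<^sub>0, \<dots>, i\<^sub>k = i\<^sub>0\<close> in \<open>{1..N}\<close> of the traces of \<open>A j\<^sub>1 * \<dots> * A j\<^sub>k\<close>, where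
  \<open>j\<^sub>l = N + 1 - i\<^sub>l\<^sub>-\<^sub>1 - i\<^sub>l\<close>. The theorem enumerates the same walks by their start \<open>i\<close> and
  their steps \<open>j\<close>. Write \<open>x\<^sub>l\<close> for \<open>i\<close> minus the alternating sum of the first \<open>l\<close> steps. Then
  the walk stands at \<open>x\<^sub>l\<close> after an even number \<open>l\<close> of steps and at \<open>N + 1 - x\<^sub>l\<close> after an odd
  number, because each Hankel step reflects the interval. The reflection preserves \<open>{1..N}\<close>, so
  the product of the indicators of \<open>x\<^sub>l\<close> says exactly that the walk stays in \<open>{1..N}\<close>, and the
  Kronecker delta says that the walk is closed; this is where the parity of \<open>k\<close> enters.

  Lemma \<open>block_hankel_power_index\<close> proves this, by induction on \<open>k\<close>, for a single entry of \<open>H ^ k\<close>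
  and hence for walks with any end point; the trace is then read off. The expansion of
  \<open>tr (A j\<^sub>1 * \<dots> * A j\<^sub>k)\<close> into scalars is the same argument for walks through the entries of the
  blocks, and is reduced to \<open>mat_list_prod_index\<close>.
\<close>

section \<open>Sums over finite sequences\<close>

text \<open>Both walk expansions proceed by splitting off the last step of the walk.\<close>

lemma sum_PiE_Suc:
  fixes f :: "(nat \<Rightarrow> 'b) \<Rightarrow> 'c::comm_monoid_add"
  shows "(\<Sum>g \<in> {1..Suc k} \<rightarrow>\<^sub>E X. f g) = (\<Sum>g \<in> {1..k} \<rightarrow>\<^sub>E X. \<Sum>y \<in> X. f (g(Suc k := y)))"
proof -
  have ins: "{1..Suc k} = insert (Suc k) {1..k}" by auto
  have inj: "inj_on (\<lambda>(y, g). g(Suc k := y)) (X \<times> ({1..k} \<rightarrow>\<^sub>E X))"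
    using inj_combinator[of "Suc k" "{1..k}" "\<lambda>_. X"] by simp
  have "(\<Sum>g \<in> {1..Suc k} \<rightarrow>\<^sub>E X. f g) = (\<Sum>(y, g) \<in> X \<times> ({1..k} \<rightarrow>\<^sub>E X). f (g(Suc k := y)))"
    unfolding ins PiE_insert_eq sum.reindex[OF inj] by (simp add: o_def case_prod_unfold)
  also have "\<dots> = (\<Sum>y \<in> X. \<Sum>g \<in> {1..k} \<rightarrow>\<^sub>E X. f (g(Suc k := y)))"
    by (simp add: sum.cartesian_product)
  also have "\<dots> = (\<Sum>g \<in> {1..k} \<rightarrow>\<^sub>E X. \<Sum>y \<in> X. f (g(Suc k := y)))"
    by (rule sum.swap)
  finally show ?thesis .
qed

lemma sum_from_1: "(\<Sum>i = 1..n. f i) = (\<Sum>i<n. f (i + 1))" for n :: nat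
  by (simp add: sum.atLeast1_atMost_eq)

section \<open>Products of lists of matrices\<close>

lemma mat_list_prod_carrier:
  "(\<And>B. B \<in> set Bs \<Longrightarrow> B \<in> carrier_mat m m) \<Longrightarrow> mat_list_prod m Bs \<in> carrier_mat m m"
  unfolding mat_list_prod_def by (induction Bs) (auto intro!: mult_carrier_mat)

lemma mat_list_prod_snoc:
  assumes "\<And>B. B \<in> set Bs \<Longrightarrow> B \<in> carrier_mat m m" and C: "C \<in> carrier_mat m m"
  shows "mat_list_prod m (Bs @ [C]) = mat_list_prod m Bs * C"
  using assms(1)
proof (induction Bs)
  case Nil
  then show ?case using C by (simp add: mat_list_prod_def)
next
  case (Cons B Bs)
  have "mat_list_prod m Bs \<in> carrier_mat m m"
    by (rule mat_list_prod_carrier) (use Cons.prems in auto)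
  moreover have "B \<in> carrier_mat m m" using Cons.prems by simp
  moreover have "mat_list_prod m (Bs @ [C]) = mat_list_prod m Bs * C"
    using Cons by simp
  ultimately show ?case
    using C by (simp add: mat_list_prod_def assoc_mult_mat[of _ m m _ m _ m])
qed

lemma mat_mult_index_sum:
  assumes "X \<in> carrier_mat n n" "Y \<in> carrier_mat n n" "r < n" "c < n"
  shows "(X * Y) $$ (r, c) = (\<Sum>s<n. X $$ (r, s) * Y $$ (s, c))"
  using assms by (auto simp: scalar_prod_def atLeast0LessThan intro!: sum.cong)

text \<open>
  The factor \<open>kronecker_delta\<close> fixes the start of the walk \<open>t\<close>, so that the sum runs over all walks
  and can be peeled from the end; the column \<open>q + 1\<close> stands in for the missing vertex after the
  last one. The delta disappears when the trace sums over the start.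
\<close>

lemma mat_list_prod_index:
  fixes a :: "nat \<Rightarrow> nat \<Rightarrow> int \<Rightarrow> 'a::comm_semiring_1"
  assumes "\<And>l. l \<in> {1..Suc k} \<Longrightarrow> A (j l) = mat m m (\<lambda>(p, q). a (p + 1) (q + 1) (j l))"
    and "p < m" and "q < m"
  shows "mat_list_prod m (map (\<lambda>l. A (j l)) [1..<Suc k + 1]) $$ (p, q) =
    (\<Sum>t \<in> {1..Suc k} \<rightarrow>\<^sub>E {1..m}. kronecker_delta (p + 1) (t 1) *
       (\<Prod>l = 1..Suc k. a (t l) (if l = Suc k then q + 1 else t (l + 1)) (j l)))"
  using assms
proof (induction k arbitrary: q)
  case 0
  have "A (j 1) \<in> carrier_mat m m" using "0.prems"(1)[of 1] by simp
  then have "mat_list_prod m (map (\<lambda>l. A (j l)) [1..<Suc 0 + 1]) $$ (p, q) = a (p + 1) (q + 1) (j 1)"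
    using "0.prems" by (simp add: mat_list_prod_def)
  moreover have "p + 1 \<in> {1..m}" using "0.prems" by simp
  ultimately show ?case
    unfolding sum_PiE_Suc by (simp add: kronecker_delta_def if_distrib[of "\<lambda>x. x * _"] cong: if_cong)
next
  case (Suc k)
  let ?P = "mat_list_prod m (map (\<lambda>l. A (j l)) [1..<Suc k + 1])"
  let ?w = "\<lambda>t k c. kronecker_delta (p + 1) (t 1) *
              (\<Prod>l = 1..Suc k. a (t l) (if l = Suc k then c else t (l + 1)) (j l)) :: 'a"
  have A: "A (j l) \<in> carrier_mat m m" if "l \<in> {1..Suc (Suc k)}" for l
    using Suc.prems(1)[OF that] by simp
  have P: "?P \<in> carrier_mat m m"
    by (rule mat_list_prod_carrier) (use A in auto)
  have "map (\<lambda>l. A (j l)) [1..<Suc (Suc k) + 1] =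
      map (\<lambda>l. A (j l)) [1..<Suc k + 1] @ [A (j (Suc (Suc k)))]"
    by simp
  moreover have "mat_list_prod m (map (\<lambda>l. A (j l)) [1..<Suc k + 1] @ [A (j (Suc (Suc k)))]) =
      ?P * A (j (Suc (Suc k)))"
    by (rule mat_list_prod_snoc) (use A in auto)
  ultimately have "mat_list_prod m (map (\<lambda>l. A (j l)) [1..<Suc (Suc k) + 1]) =
      ?P * A (j (Suc (Suc k)))"
    by (simp only:)
  then have "mat_list_prod m (map (\<lambda>l. A (j l)) [1..<Suc (Suc k) + 1]) $$ (p, q) =
      (\<Sum>s<m. ?P $$ (p, s) * A (j (Suc (Suc k))) $$ (s, q))"
    using mat_mult_index_sum[OF P A[of "Suc (Suc k)"]] Suc.prems by simp
  also have "\<dots> = (\<Sum>s<m. (\<Sum>t \<in> {1..Suc k} \<rightarrow>\<^sub>E {1..m}. ?w t k (s + 1)) * a (s + 1) (q + 1) (j (Suc (Suc k))))"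
  proof (rule sum.cong[OF refl])
    fix s assume s: "s \<in> {..<m}"
    show "?P $$ (p, s) * A (j (Suc (Suc k))) $$ (s, q) =
       (\<Sum>t \<in> {1..Suc k} \<rightarrow>\<^sub>E {1..m}. ?w t k (s + 1)) * a (s + 1) (q + 1) (j (Suc (Suc k)))"
      using Suc.IH[of s] Suc.prems(1)[of "Suc (Suc k)"] Suc.prems s by simp
  qed
  also have "\<dots> = (\<Sum>y = 1..m. (\<Sum>t \<in> {1..Suc k} \<rightarrow>\<^sub>E {1..m}. ?w t k y) * a y (q + 1) (j (Suc (Suc k))))"
    by (simp only: sum_from_1)
  also have "\<dots> = (\<Sum>t \<in> {1..Suc k} \<rightarrow>\<^sub>E {1..m}. \<Sum>y = 1..m. ?w t k y * a y (q + 1) (j (Suc (Suc k))))"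
    unfolding sum_distrib_right by (rule sum.swap)
  also have "\<dots> = (\<Sum>t \<in> {1..Suc k} \<rightarrow>\<^sub>E {1..m}. \<Sum>y = 1..m. ?w (t(Suc (Suc k) := y)) (Suc k) (q + 1))"
  proof (intro sum.cong refl)
    fix t y
    have "(\<Prod>l = 1..Suc k. a (t l) (if l = Suc k then y else t (l + 1)) (j l)) =
      (\<Prod>l = 1..Suc k. a ((t(Suc (Suc k) := y)) l)
         (if l = Suc (Suc k) then q + 1 else (t(Suc (Suc k) := y)) (l + 1)) (j l))"
      by (rule prod.cong) auto
    then show "?w t k y * a y (q + 1) (j (Suc (Suc k))) = ?w (t(Suc (Suc k) := y)) (Suc k) (q + 1)"
      by (simp add: mult_ac)
  qed
  finally show ?case by (simp only: sum_PiE_Suc)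
qed

lemma trace_mat_list_prod:
  fixes a :: "nat \<Rightarrow> nat \<Rightarrow> int \<Rightarrow> 'a::comm_semiring_1"
  assumes A: "\<And>l. l \<in> {1..k} \<Longrightarrow> A (j l) = mat m m (\<lambda>(p, q). a (p + 1) (q + 1) (j l))"
    and "k \<ge> 1"
  shows "mat_trace (mat_list_prod m (map (\<lambda>l. A (j l)) [1..<k + 1])) =
    (\<Sum>t \<in> {1..k} \<rightarrow>\<^sub>E {1..m}. \<Prod>l = 1..k. a (t l) (t (if l = k then 1 else l + 1)) (j l))"
proof -
  obtain k' where k: "k = Suc k'" using \<open>k \<ge> 1\<close> by (cases k) auto
  let ?P = "mat_list_prod m (map (\<lambda>l. A (j l)) [1..<k + 1])"
  let ?w = "\<lambda>t c. \<Prod>l = 1..k. a (t l) (if l = k then c else t (l + 1)) (j l)"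
  have "?P \<in> carrier_mat m m"
    by (rule mat_list_prod_carrier) (use A in auto)
  then have "mat_trace ?P = (\<Sum>p<m. ?P $$ (p, p))"
    by (simp add: mat_trace_def)
  also have "\<dots> = (\<Sum>p<m. \<Sum>t \<in> {1..k} \<rightarrow>\<^sub>E {1..m}. kronecker_delta (p + 1) (t 1) * ?w t (p + 1))"
    using mat_list_prod_index[of k' A j m a] A by (auto simp: k intro!: sum.cong)
  also have "\<dots> = (\<Sum>c = 1..m. \<Sum>t \<in> {1..k} \<rightarrow>\<^sub>E {1..m}. kronecker_delta c (t 1) * ?w t c)"
    by (simp only: sum_from_1)
  also have "\<dots> = (\<Sum>t \<in> {1..k} \<rightarrow>\<^sub>E {1..m}. \<Sum>c = 1..m. kronecker_delta c (t 1) * ?w t c)"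
    by (rule sum.swap)
  also have "\<dots> = (\<Sum>t \<in> {1..k} \<rightarrow>\<^sub>E {1..m}. ?w t (t 1))"
  proof (rule sum.cong[OF refl])
    fix t assume "t \<in> {1..k} \<rightarrow>\<^sub>E {1..m}"
    then have "t 1 \<in> {1..m}" using \<open>k \<ge> 1\<close> by (auto simp: PiE_iff)
    then show "(\<Sum>c = 1..m. kronecker_delta c (t 1) * ?w t c) = ?w t (t 1)"
      by (simp add: kronecker_delta_def if_distrib[of "\<lambda>x. x * _"] cong: if_cong)
  qed
  also have "\<dots> = (\<Sum>t \<in> {1..k} \<rightarrow>\<^sub>E {1..m}. \<Prod>l = 1..k. a (t l) (t (if l = k then 1 else l + 1)) (j l))"
    by (intro sum.cong prod.cong) auto
  finally show ?thesis .
qed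

section \<open>Entries of block matrices\<close>

text \<open>Blocks are numbered from 1, but positions inside a block from 0.\<close>

definition block_index :: "nat \<Rightarrow> nat \<Rightarrow> nat \<Rightarrow> nat" where
  "block_index m i p = (i - 1) * m + p"

lemma sum_block_index:
  "(\<Sum>r<m * N. f r) = (\<Sum>i = 1..N. \<Sum>p<m. f (block_index m i p))"
proof -
  have "(\<Sum>r<m * N. f r) = (\<Sum>i<N. sum f {i * m..<i * m + m})"
    by (simp add: sum.nat_group mult.commute)
  also have "\<dots> = (\<Sum>i<N. \<Sum>p<m. f (i * m + p))"
  proof (rule sum.cong[OF refl])
    fix i
    show "sum f {i * m..<i * m + m} = (\<Sum>p<m. f (i * m + p))"
      using sum.shift_bounds_nat_ivl[of f 0 "i * m" m]
      by (simp add: add.commute atLeast0LessThan)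
  qed
  also have "\<dots> = (\<Sum>i = 1..N. \<Sum>p<m. f (block_index m i p))"
    by (simp add: sum.atLeast1_atMost_eq block_index_def)
  finally show ?thesis .
qed

lemma block_index_less:
  assumes "i \<in> {1..N}" "p < m"
  shows "block_index m i p < m * N"
proof -
  have "block_index m i p < (i - 1) * m + m" using assms by (simp add: block_index_def)
  also have "\<dots> = i * m" using assms by (cases i) auto
  also have "\<dots> \<le> m * N" using assms by simp
  finally show ?thesis .
qed

lemma block_index_eq_iff:
  assumes "i \<ge> 1" "i' \<ge> 1" "p < m" "p' < m"
  shows "block_index m i p = block_index m i' p' \<longleftrightarrow> i = i' \<and> p = p'"
proof
  assume eq: "block_index m i p = block_index m i' p'"
  have "block_index m i p mod m = p" "block_index m i' p' mod m = p'"
    "block_index m i p div m = i - 1" "block_index m i' p' div m = i' - 1"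
    using assms by (auto simp: block_index_def)
  then show "i = i' \<and> p = p'" using eq assms by (metis le_add_diff_inverse)
qed simp

lemma block_mat_carrier: "block_mat m N B \<in> carrier_mat (m * N) (m * N)"
  by (simp add: block_mat_def)

lemma block_mat_index:
  assumes "i \<in> {1..N}" "c \<in> {1..N}" "p < m" "q < m"
  shows "block_mat m N B $$ (block_index m i p, block_index m c q) = B i c $$ (p, q)"
  using assms block_index_less[of i N p m] block_index_less[of c N q m]
  by (simp add: block_mat_def block_index_def)

lemma mat_mult_block_index:
  assumes "X \<in> carrier_mat (m * N) (m * N)" "Y \<in> carrier_mat (m * N) (m * N)"
    and "i \<in> {1..N}" "c \<in> {1..N}" "p < m" "q < m"
  shows "(X * Y) $$ (block_index m i p, block_index m c q) =
    (\<Sum>d = 1..N. \<Sum>s<m. X $$ (block_index m i p, block_index m d s) *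
                         Y $$ (block_index m d s, block_index m c q))"
  using mat_mult_index_sum[OF assms(1,2) block_index_less block_index_less] assms(3-)
  by (simp add: sum_block_index)

lemma block_hankel_carrier:
  "block_exchange m N * block_toeplitz m N A \<in> carrier_mat (m * N) (m * N)"
  unfolding block_exchange_def block_toeplitz_def
  by (rule mult_carrier_mat[OF block_mat_carrier block_mat_carrier])

lemma block_hankel_index:
  fixes A :: "int \<Rightarrow> 'a::semiring_1 mat"
  assumes i: "i \<in> {1..N}" and c: "c \<in> {1..N}" and p: "p < m" and q: "q < m"
  shows "(block_exchange m N * block_toeplitz m N A) $$ (block_index m i p, block_index m c q) =
    A (int N + 1 - int i - int c) $$ (p, q)"
proof -
  let ?i' = "N + 1 - i"
  have i': "?i' \<in> {1..N}" using i by auto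
  have "(block_exchange m N * block_toeplitz m N A) $$ (block_index m i p, block_index m c q) =
      (\<Sum>d = 1..N. \<Sum>s<m. block_exchange m N $$ (block_index m i p, block_index m d s) *
         block_toeplitz m N A $$ (block_index m d s, block_index m c q))"
    by (rule mat_mult_block_index)
       (auto simp: block_exchange_def block_toeplitz_def block_mat_carrier assms[simplified])
  also have "\<dots> = (\<Sum>d = 1..N. \<Sum>s<m. if d = ?i' \<and> s = p then A (int d - int c) $$ (s, q) else 0)"
    by (intro sum.cong refl)
       (use assms in \<open>auto simp: block_exchange_def block_toeplitz_def block_mat_index\<close>)
  also have "\<dots> = (\<Sum>d = 1..N. if d = ?i' then A (int d - int c) $$ (p, q) else 0)"
    using p by (intro sum.cong refl) auto
  also have "\<dots> = A (int ?i' - int c) $$ (p, q)"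
    using i' by simp
  finally show ?thesis using i by (simp add: of_nat_diff algebra_simps)
qed

section \<open>Powers of block Hankel matrices\<close>

text \<open>
  The block at which a walk stands after \<open>k\<close> steps, if \<open>x\<close> is its start minus the alternating sum
  of the steps.
\<close>

definition hankel_position :: "nat \<Rightarrow> nat \<Rightarrow> int \<Rightarrow> int" where
  "hankel_position N k x = (if even k then x else int N + 1 - x)"

lemma hankel_position_range:
  "hankel_position N k x \<in> {1..int N} \<longleftrightarrow> x \<in> {1..int N}"
  by (auto simp: hankel_position_def)

text \<open>The alternating signs are what makes every step, at odd and even times, act alike.\<close>

lemma hankel_position_Suc:
  "hankel_position N (Suc k) (x - (-1) ^ Suc k * y) = int N + 1 - hankel_position N k x - y"
  by (auto simp: hankel_position_def)

text \<open>
  From a walk that stands at block \<open>e\<close>, only the step \<open>N + 1 - e - c\<close> leads to block \<open>c\<close>. This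
  step lies in the range of summation as \<open>e\<close> and \<open>c\<close> lie in \<open>{1..N}\<close>, and the new indicator is then
  automatically 1, since it only asks whether \<open>c\<close> lies in \<open>{1..N}\<close>.
\<close>

lemma hankel_last_step:
  fixes f :: "int \<Rightarrow> 'a::comm_semiring_1"
  assumes c: "c \<in> {1..N}" and x: "x \<in> {1..int N}"
  shows "(\<Sum>y \<in> {- (int N - 1)..int N - 1}. f y *
            indicator {1..int N} (x - (-1) ^ Suc k * y) *
            kronecker_delta (hankel_position N (Suc k) (x - (-1) ^ Suc k * y)) (int c)) =
         (\<Sum>d = 1..N. kronecker_delta (hankel_position N k x) (int d) * f (int N + 1 - int d - int c))"
proof -
  define e where "e = nat (hankel_position N k x)"
  have e: "hankel_position N k x = int e" "e \<in> {1..N}"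
    using x hankel_position_range[of N k x] by (auto simp: e_def)
  let ?y = "int N + 1 - int e - int c"
  have y: "?y \<in> {- (int N - 1)..int N - 1}" using e(2) c by auto
  have "f y * indicator {1..int N} (x - (-1) ^ Suc k * y) *
          kronecker_delta (hankel_position N (Suc k) (x - (-1) ^ Suc k * y)) (int c) =
        (if y = ?y then f y else 0)" for y
  proof (cases "y = ?y")
    case True
    have pos: "hankel_position N (Suc k) (x - (-1) ^ Suc k * y) = int c"
      unfolding hankel_position_Suc e(1) True by simp
    then have "x - (-1) ^ Suc k * y \<in> {1..int N}"
      using hankel_position_range[of N "Suc k" "x - (-1) ^ Suc k * y"] c by simp
    then have "indicator {1..int N} (x - (-1) ^ Suc k * y) = (1::'a)"
      by (rule indicator_simps)
    then show ?thesis by (simp only: pos) (simp add: True kronecker_delta_def)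
  next
    case False
    then have "hankel_position N (Suc k) (x - (-1) ^ Suc k * y) \<noteq> int c"
      unfolding hankel_position_Suc e(1) by simp
    then show ?thesis using False by (simp only: kronecker_delta_def) simp
  qed
  then have "(\<Sum>y \<in> {- (int N - 1)..int N - 1}. f y *
            indicator {1..int N} (x - (-1) ^ Suc k * y) *
            kronecker_delta (hankel_position N (Suc k) (x - (-1) ^ Suc k * y)) (int c)) = f ?y"
    using y by (simp only: sum.delta[OF finite_atLeastAtMost_int] if_True)
  also have "\<dots> = (\<Sum>d = 1..N. kronecker_delta (hankel_position N k x) (int d) * f (int N + 1 - int d - int c))"
    using e by (simp add: kronecker_delta_def if_distrib[of "\<lambda>x. x * _"] cong: if_cong)
  finally show ?thesis .
qed

text \<open>
  The end block \<open>c\<close> is free, because an initial part of a closed walk need not be closed. Summing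
  over the block \<open>d\<close> reached after \<open>k\<close> steps or over the last step \<open>y\<close> is then the same by
  \<open>hankel_last_step\<close>, as long as the walk has stayed in \<open>{1..N}\<close> so far.
\<close>

lemma block_hankel_power_index:
  fixes A :: "int \<Rightarrow> 'a::comm_semiring_1 mat"
  assumes A: "\<And>s. s \<in> {-(int N - 1)..int N - 1} \<Longrightarrow> A s \<in> carrier_mat m m"
    and H: "H = block_exchange m N * block_toeplitz m N A"
    and i: "i \<in> {1..N}" and c: "c \<in> {1..N}" and p: "p < m" and q: "q < m"
  shows "(H ^\<^sub>m k) $$ (block_index m i p, block_index m c q) =
    (\<Sum>j \<in> {1..k} \<rightarrow>\<^sub>E {-(int N - 1)..int N - 1}.
       mat_list_prod m (map (\<lambda>l. A (j l)) [1..<k + 1]) $$ (p, q) *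
       (\<Prod>l = 1..k. indicator {1..int N} (int i - (\<Sum>q = 1..l. (-1) ^ q * j q))) *
       kronecker_delta (hankel_position N k (int i - (\<Sum>q = 1..k. (-1) ^ q * j q))) (int c))"
  using c q
proof (induction k arbitrary: c q)
  case 0
  have "dim_row H = m * N"
    by (simp add: H block_exchange_def block_mat_def)
  then show ?case
    using 0 i p block_index_less[of i N p m] block_index_less[of c N q m]
    by (auto simp: block_index_eq_iff mat_list_prod_def hankel_position_def kronecker_delta_def)
next
  case (Suc k)
  let ?b = "int N - 1"
  let ?P = "\<lambda>j k. mat_list_prod m (map (\<lambda>l. A (j l)) [1..<k + 1])"
  let ?x = "\<lambda>j l. int i - (\<Sum>q = 1..l. (-1) ^ q * j q)"
  let ?I = "\<lambda>j k. \<Prod>l = 1..k. indicator {1..int N} (?x j l) :: 'a"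
  let ?d = "\<lambda>k x c. kronecker_delta (hankel_position N k x) (int c) :: 'a"
  let ?J = "{1..k} \<rightarrow>\<^sub>E {-?b..?b}"
  have H_car: "H \<in> carrier_mat (m * N) (m * N)"
    unfolding H by (rule block_hankel_carrier)
  have step: "(\<Sum>y \<in> {-?b..?b}. ?P (j(Suc k := y)) (Suc k) $$ (p, q) * ?I (j(Suc k := y)) (Suc k) *
                 ?d (Suc k) (?x (j(Suc k := y)) (Suc k)) c) =
      (\<Sum>d = 1..N. \<Sum>s<m. ?P j k $$ (p, s) * ?I j k * ?d k (?x j k) d *
          A (int N + 1 - int d - int c) $$ (s, q))"
    if j: "j \<in> ?J" for j
  proof -
    have Aj: "A (j l) \<in> carrier_mat m m" if "l \<in> {1..k}" for l
      using A j that by (auto simp: PiE_iff)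
    have P: "?P j k \<in> carrier_mat m m"
      by (rule mat_list_prod_carrier) (use Aj in auto)
    have x_upd: "?x (j(Suc k := y)) l = ?x j l" if "l \<le> k" for y l
      using that by (auto intro!: sum.cong)
    have x_Suc: "?x (j(Suc k := y)) (Suc k) = ?x j k - (-1) ^ Suc k * y" for y
      using x_upd[of k y] by simp
    have I_Suc: "?I (j(Suc k := y)) (Suc k) =
        ?I j k * indicator {1..int N} (?x j k - (-1) ^ Suc k * y)" for y
    proof -
      have "?I (j(Suc k := y)) k = ?I j k"
        by (intro prod.cong refl) (use x_upd in \<open>metis atLeastAtMost_iff\<close>)
      moreover have "?I (j(Suc k := y)) (Suc k) =
          ?I (j(Suc k := y)) k * indicator {1..int N} (?x (j(Suc k := y)) (Suc k))"
        by (simp add: mult.commute)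
      ultimately show ?thesis by (simp only: x_Suc)
    qed
    define f where "f y = (\<Sum>s<m. ?P j k $$ (p, s) * A y $$ (s, q))" for y
    have P_Suc: "?P (j(Suc k := y)) (Suc k) $$ (p, q) = f y" if y: "y \<in> {-?b..?b}" for y
    proof -
      have "map (\<lambda>l. A ((j(Suc k := y)) l)) [1..<Suc k + 1] = map (\<lambda>l. A (j l)) [1..<k + 1] @ [A y]"
        by auto
      moreover have "mat_list_prod m (map (\<lambda>l. A (j l)) [1..<k + 1] @ [A y]) = ?P j k * A y"
        by (rule mat_list_prod_snoc) (use Aj A[OF y] in auto)
      ultimately have "?P (j(Suc k := y)) (Suc k) = ?P j k * A y"
        by (simp only:)
      then show ?thesis
        unfolding f_def using mat_mult_index_sum[OF P A[OF y] p Suc.prems(2)] by simp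
    qed
    have "(\<Sum>y \<in> {-?b..?b}. ?P (j(Suc k := y)) (Suc k) $$ (p, q) * ?I (j(Suc k := y)) (Suc k) *
              ?d (Suc k) (?x (j(Suc k := y)) (Suc k)) c) =
        (\<Sum>y \<in> {-?b..?b}. ?I j k * (f y * indicator {1..int N} (?x j k - (-1) ^ Suc k * y) *
              ?d (Suc k) (?x j k - (-1) ^ Suc k * y) c))"
      by (intro sum.cong refl) (simp only: P_Suc I_Suc x_Suc mult_ac)
    also have "\<dots> = ?I j k * (\<Sum>y \<in> {-?b..?b}. f y * indicator {1..int N} (?x j k - (-1) ^ Suc k * y) *
              ?d (Suc k) (?x j k - (-1) ^ Suc k * y) c)"
      by (simp only: sum_distrib_left)
    also have "\<dots> = ?I j k * (\<Sum>d = 1..N. ?d k (?x j k) d * f (int N + 1 - int d - int c))"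
    proof (cases "?x j k \<in> {1..int N}")
      case True
      then show ?thesis by (simp only: hankel_last_step[OF Suc.prems(1)])
    next
      \<comment> \<open>A walk that has already left \<open>{1..N}\<close> is killed by its last indicator; it has made a
          step, as its start lies in \<open>{1..N}\<close>.\<close>
      case False
      then have "k \<noteq> 0" using i by (cases k) auto
      then have "?I j k = 0"
        using False by (intro prod_zero bexI[of _ k]) auto
      then show ?thesis by (simp only: mult_zero_left)
    qed
    also have "\<dots> = (\<Sum>d = 1..N. \<Sum>s<m. ?P j k $$ (p, s) * ?I j k * ?d k (?x j k) d *
          A (int N + 1 - int d - int c) $$ (s, q))"
      unfolding f_def sum_distrib_left by (simp only: mult_ac)
    finally show ?thesis .
  qed
  have "(H ^\<^sub>m Suc k) $$ (block_index m i p, block_index m c q) =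
      (\<Sum>d = 1..N. \<Sum>s<m. (H ^\<^sub>m k) $$ (block_index m i p, block_index m d s) *
         H $$ (block_index m d s, block_index m c q))"
    using mat_mult_block_index[OF pow_carrier_mat[OF H_car] H_car i Suc.prems(1) p Suc.prems(2)]
    by simp
  also have "\<dots> = (\<Sum>d = 1..N. \<Sum>s<m. \<Sum>j \<in> ?J. ?P j k $$ (p, s) * ?I j k * ?d k (?x j k) d *
      A (int N + 1 - int d - int c) $$ (s, q))"
  proof (intro sum.cong refl)
    fix d s assume d: "d \<in> {1..N}" and "s \<in> {..<m}"
    then have s: "s < m" by simp
    have "H $$ (block_index m d s, block_index m c q) = A (int N + 1 - int d - int c) $$ (s, q)"
      unfolding H by (rule block_hankel_index[OF d Suc.prems(1) s Suc.prems(2)])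
    then show "(H ^\<^sub>m k) $$ (block_index m i p, block_index m d s) *
         H $$ (block_index m d s, block_index m c q) =
      (\<Sum>j \<in> ?J. ?P j k $$ (p, s) * ?I j k * ?d k (?x j k) d *
         A (int N + 1 - int d - int c) $$ (s, q))"
      by (simp only: Suc.IH[OF d s] sum_distrib_right)
  qed
  also have "\<dots> = (\<Sum>j \<in> ?J. \<Sum>d = 1..N. \<Sum>s<m. ?P j k $$ (p, s) * ?I j k * ?d k (?x j k) d *
      A (int N + 1 - int d - int c) $$ (s, q))"
    by (subst sum.swap[of _ _ "{..<m}"], subst sum.swap[of _ _ "{1..N}"])
       (intro sum.cong refl sum.swap)
  also have "\<dots> = (\<Sum>j \<in> ?J. \<Sum>y \<in> {-?b..?b}. ?P (j(Suc k := y)) (Suc k) $$ (p, q) *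
      ?I (j(Suc k := y)) (Suc k) * ?d (Suc k) (?x (j(Suc k := y)) (Suc k)) c)"
    by (rule sum.cong[OF refl step[symmetric]])
  finally show ?case by (simp only: sum_PiE_Suc)
qed

lemma trace_block_hankel_power:
  fixes A :: "int \<Rightarrow> 'a::comm_semiring_1 mat"
  assumes A: "\<And>s. s \<in> {-(int N - 1)..int N - 1} \<Longrightarrow> A s \<in> carrier_mat m m"
    and H: "H = block_exchange m N * block_toeplitz m N A"
  shows "mat_trace (H ^\<^sub>m k) =
    (\<Sum>i = 1..N. \<Sum>j \<in> {1..k} \<rightarrow>\<^sub>E {-(int N - 1)..int N - 1}.
       mat_trace (mat_list_prod m (map (\<lambda>l. A (j l)) [1..<k + 1])) *
       (\<Prod>l = 1..k. indicator {1..int N} (int i - (\<Sum>q = 1..l. (-1) ^ q * j q))) *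
       kronecker_delta (hankel_position N k (int i - (\<Sum>q = 1..k. (-1) ^ q * j q))) (int i))"
proof -
  let ?J = "{1..k} \<rightarrow>\<^sub>E {-(int N - 1)..int N - 1}"
  let ?P = "\<lambda>j. mat_list_prod m (map (\<lambda>l. A (j l)) [1..<k + 1])"
  let ?I = "\<lambda>i j. \<Prod>l = 1..k. indicator {1..int N} (int i - (\<Sum>q = 1..l. (-1) ^ q * j q)) :: 'a"
  let ?d = "\<lambda>i j. kronecker_delta (hankel_position N k (int i - (\<Sum>q = 1..k. (-1) ^ q * j q))) (int i) :: 'a"
  have "H \<in> carrier_mat (m * N) (m * N)"
    unfolding H by (rule block_hankel_carrier)
  then have "dim_row (H ^\<^sub>m k) = m * N"
    using pow_carrier_mat by blast
  then have "mat_trace (H ^\<^sub>m k) = (\<Sum>i = 1..N. \<Sum>p<m. (H ^\<^sub>m k) $$ (block_index m i p, block_index m i p))"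
    by (simp add: mat_trace_def sum_block_index)
  also have "\<dots> = (\<Sum>i = 1..N. \<Sum>p<m. \<Sum>j \<in> ?J. ?P j $$ (p, p) * ?I i j * ?d i j)"
    by (intro sum.cong refl block_hankel_power_index[OF A H]) auto
  also have "\<dots> = (\<Sum>i = 1..N. \<Sum>j \<in> ?J. \<Sum>p<m. ?P j $$ (p, p) * ?I i j * ?d i j)"
    by (intro sum.cong refl sum.swap)
  also have "\<dots> = (\<Sum>i = 1..N. \<Sum>j \<in> ?J. mat_trace (?P j) * ?I i j * ?d i j)"
  proof (intro sum.cong refl)
    fix i j assume j: "j \<in> ?J"
    have "?P j \<in> carrier_mat m m"
      by (rule mat_list_prod_carrier) (use A j in \<open>auto simp: PiE_iff\<close>)
    then have "mat_trace (?P j) = (\<Sum>p<m. ?P j $$ (p, p))"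
      by (simp add: mat_trace_def)
    then show "(\<Sum>p<m. ?P j $$ (p, p) * ?I i j * ?d i j) = mat_trace (?P j) * ?I i j * ?d i j"
      by (simp only: sum_distrib_right)
  qed
  finally show ?thesis .
qed

theorem lemma2p3:
  fixes m N k :: nat
    and b :: int
    and a :: "nat \<Rightarrow> nat \<Rightarrow> int \<Rightarrow> 'a::comm_ring_1"
    and A :: "int \<Rightarrow> 'a mat"
    and T H :: "'a mat"
  assumes "m \<ge> 1" and "N \<ge> 1" and "k \<ge> 1"
    and "b = int N - 1"
    and "\<And>s. s \<in> {-b..b} \<Longrightarrow> A s = mat m m (\<lambda>(p, q). a (p + 1) (q + 1) s)"
    and "T = block_toeplitz m N A"
    and "H = block_exchange m N * T"
  shows
    "(even k \<longrightarrow>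
        mat_trace (H ^\<^sub>m k) =
          (\<Sum>i = 1..N. \<Sum>j \<in> {1..k} \<rightarrow>\<^sub>E {-b..b}.
             mat_trace (mat_list_prod m (map (\<lambda>l. A (j l)) [1..<k + 1])) *
             (\<Prod>l = 1..k. indicator {1..int N} (int i - (\<Sum>q = 1..l. (-1) ^ q * j q))) *
             kronecker_delta 0 (\<Sum>q = 1..k. (-1) ^ q * j q))) \<and>
     (odd k \<longrightarrow>
        mat_trace (H ^\<^sub>m k) =
          (\<Sum>i = 1..N. \<Sum>j \<in> {1..k} \<rightarrow>\<^sub>E {-b..b}.
             mat_trace (mat_list_prod m (map (\<lambda>l. A (j l)) [1..<k + 1])) *
             (\<Prod>l = 1..k. indicator {1..int N} (int i - (\<Sum>q = 1..l. (-1) ^ q * j q))) *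
             kronecker_delta (2 * int i - 1 - int N) (\<Sum>q = 1..k. (-1) ^ q * j q))) \<and>
     (\<forall>j \<in> {1..k} \<rightarrow>\<^sub>E {-b..b}.
        mat_trace (mat_list_prod m (map (\<lambda>l. A (j l)) [1..<k + 1])) =
          (\<Sum>t \<in> {1..k} \<rightarrow>\<^sub>E {1..m}.
             \<Prod>l = 1..k. a (t l) (t (if l = k then 1 else l + 1)) (j l)))"
proof -
  have A: "A s \<in> carrier_mat m m" if "s \<in> {-(int N - 1)..int N - 1}" for s
    using assms(5)[of s] that \<open>b = int N - 1\<close> by simp
  have H: "H = block_exchange m N * block_toeplitz m N A"
    using assms by simp
  note trace = trace_block_hankel_power[OF A H, of k, folded \<open>b = int N - 1\<close>]
  have even_delta: "kronecker_delta (hankel_position N k (int i - S)) (int i) = (kronecker_delta 0 S :: 'a)"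
    if "even k" for i S
    using that by (auto simp: kronecker_delta_def hankel_position_def)
  have odd_delta: "kronecker_delta (hankel_position N k (int i - S)) (int i) =
      (kronecker_delta (2 * int i - 1 - int N) S :: 'a)"
    if "odd k" for i S
    using that by (auto simp: kronecker_delta_def hankel_position_def)
  show ?thesis
  proof (intro conjI impI ballI, goal_cases)
    case 1
    then show ?case by (simp only: trace even_delta)
  next
    case 2
    then show ?case by (simp only: trace odd_delta not_False_eq_True)
  next
    case (3 j)
    then have "A (j l) = mat m m (\<lambda>(p, q). a (p + 1) (q + 1) (j l))" if "l \<in> {1..k}" for l
      using assms(5) that by (auto simp: PiE_iff)
    then show ?case
      using \<open>k \<ge> 1\<close> by (rule trace_mat_list_prod)
  qed
qed

end
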